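(* The category $\mathrm{DVect}$ of diffeological vector spaces and smooth linear maps is cocomplete, i.e. it has all small colimits.
   Context: A diffeological space is a set $X$ together with a specified set of functions $U\to X$ (called plots), for every open set $U\subseteq\mathbb{R}^n$ and every $n\in\mathbb{N}=\{0,1,2,\dots\}$, such that: (1) every constant map $U\to X$ is a plot; (2) if $U\to X$ is a plot and $V\to U$ is a smooth map between open subsets of Euclidean spaces, then $V\to U\to X$ is a plot; (3) if $U=\bigcup_i U_i$ is an open cover and $U\to X$ is a map whose restrictions to all $U_i$ are plots, then $U\to X$ is a plot. A map between diffeological spaces is smooth if composing with it sends plots to plots. Products carry the product diffeology (a map into a product is a plot iff all its components are plots), and $\mathbb{R}$ carries the standard diffeology (plots are the usual smooth functions). A diffeological vector space is a real vector space $V$ with a diffeology such that addition $V\times V\to V$ and scalar multiplication $\mathbb{R}\times V\to V$ are smooth. $\mathrm{DVect}$ is the category of diffeological vector spaces and maps that are both smooth and linear. *)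

theory Defs
  imports "HOL-Analysis.Analysis" "HOL-Algebra.Module"
begin

section \<open>Categories, functors and colimits\<close>

record ('o, 'm) cat =
  Ob :: "'o set"
  Ar :: "'m set"
  Dom :: "'m \<Rightarrow> 'o"
  Cod :: "'m \<Rightarrow> 'o"
  Idt :: "'o \<Rightarrow> 'm"
  Comp :: "'m \<Rightarrow> 'm \<Rightarrow> 'm"  \<comment> \<open>\<open>Comp C g f\<close> is \<open>g\<close> after \<open>f\<close>\<close>

definition Hom :: "('o, 'm) cat \<Rightarrow> 'o \<Rightarrow> 'o \<Rightarrow> 'm set" where
  "Hom C x y = {f \<in> Ar C. Dom C f = x \<and> Cod C f = y}"

locale category =
  fixes C :: "('o, 'm) cat"
  assumes Dom_closed: "f \<in> Ar C \<Longrightarrow> Dom C f \<in> Ob C"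
    and Cod_closed: "f \<in> Ar C \<Longrightarrow> Cod C f \<in> Ob C"
    and Idt_Hom: "x \<in> Ob C \<Longrightarrow> Idt C x \<in> Hom C x x"
    and Comp_Hom: "\<lbrakk>f \<in> Hom C x y; g \<in> Hom C y z\<rbrakk> \<Longrightarrow> Comp C g f \<in> Hom C x z"
    and Comp_Idt_left: "f \<in> Hom C x y \<Longrightarrow> Comp C (Idt C y) f = f"
    and Comp_Idt_right: "f \<in> Hom C x y \<Longrightarrow> Comp C f (Idt C x) = f"
    and Comp_assoc: "\<lbrakk>f \<in> Hom C w x; g \<in> Hom C x y; h \<in> Hom C y z\<rbrakk> \<Longrightarrow>
      Comp C h (Comp C g f) = Comp C (Comp C h g) f"

text \<open>A functor is given by its object map \<open>Fo\<close> and its arrow map \<open>Fa\<close>; their values outside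
  \<open>Ob J\<close> and \<open>Ar J\<close> are irrelevant.\<close>

locale cat_functor = J: category J + C: category C
  for J :: "('i, 'j) cat" and C :: "('o, 'm) cat" and Fo :: "'i \<Rightarrow> 'o" and Fa :: "'j \<Rightarrow> 'm" +
  assumes Fo_Ob: "i \<in> Ob J \<Longrightarrow> Fo i \<in> Ob C"
    and Fa_Hom: "a \<in> Hom J i k \<Longrightarrow> Fa a \<in> Hom C (Fo i) (Fo k)"
    and Fa_Idt: "i \<in> Ob J \<Longrightarrow> Fa (Idt J i) = Idt C (Fo i)"
    and Fa_Comp: "\<lbrakk>a \<in> Hom J i k; b \<in> Hom J k l\<rbrakk> \<Longrightarrow>
      Fa (Comp J b a) = Comp C (Fa b) (Fa a)"

definition cocone ::
  "('i, 'j) cat \<Rightarrow> ('o, 'm) cat \<Rightarrow> ('i \<Rightarrow> 'o) \<Rightarrow> ('j \<Rightarrow> 'm) \<Rightarrow> 'o \<Rightarrow> ('i \<Rightarrow> 'm) \<Rightarrow> bool" where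
  "cocone J C Fo Fa c \<iota> \<longleftrightarrow>
     c \<in> Ob C \<and>
     (\<forall>i\<in>Ob J. \<iota> i \<in> Hom C (Fo i) c) \<and>
     (\<forall>a\<in>Ar J. Comp C (\<iota> (Cod J a)) (Fa a) = \<iota> (Dom J a))"

definition colimit ::
  "('i, 'j) cat \<Rightarrow> ('o, 'm) cat \<Rightarrow> ('i \<Rightarrow> 'o) \<Rightarrow> ('j \<Rightarrow> 'm) \<Rightarrow> 'o \<Rightarrow> ('i \<Rightarrow> 'm) \<Rightarrow> bool" where
  "colimit J C Fo Fa c \<iota> \<longleftrightarrow>
     cocone J C Fo Fa c \<iota> \<and>
     (\<forall>d \<mu>. cocone J C Fo Fa d \<mu> \<longrightarrow>
        (\<exists>!h. h \<in> Hom C c d \<and> (\<forall>i\<in>Ob J. Comp C h (\<iota> i) = \<mu> i)))"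

text \<open>A type \<open>'u\<close> plays the role of the universe: a small category is one whose objects and arrows
  form subsets of \<open>'u\<close>.\<close>

definition cocomplete :: "'u itself \<Rightarrow> ('o, 'm) cat \<Rightarrow> bool" where
  "cocomplete U C \<longleftrightarrow>
     category C \<and>
     (\<forall>(J :: ('u, 'u) cat) Fo Fa. cat_functor J C Fo Fa \<longrightarrow> (\<exists>c \<iota>. colimit J C Fo Fa c \<iota>))"


section \<open>Smooth maps between open subsets of Euclidean spaces\<close>

text \<open>Points of the \<open>n\<close>-dimensional space are the functions \<open>nat \<Rightarrow> real\<close> vanishing at all
  \<open>i \<ge> n\<close>. A function on an open set is of class \<open>k\<close> if all its iterated partial derivatives up
  to order \<open>k\<close> exist and are continuous.\<close>

fun Ck_on :: "nat \<Rightarrow> nat \<Rightarrow> (nat \<Rightarrow> real) set \<Rightarrow> ((nat \<Rightarrow> real) \<Rightarrow> real) \<Rightarrow> bool" where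
  "Ck_on 0 n U f \<longleftrightarrow> continuous_map (subtopology (Euclidean_space n) U) euclideanreal f"
| "Ck_on (Suc k) n U f \<longleftrightarrow>
     continuous_map (subtopology (Euclidean_space n) U) euclideanreal f \<and>
     (\<forall>i<n. \<exists>g. (\<forall>x\<in>U. ((\<lambda>t. f (x(i := t))) has_real_derivative g x) (at (x i))) \<and> Ck_on k n U g)"

definition smooth_fun_on :: "nat \<Rightarrow> (nat \<Rightarrow> real) set \<Rightarrow> ((nat \<Rightarrow> real) \<Rightarrow> real) \<Rightarrow> bool" where
  "smooth_fun_on n U f \<longleftrightarrow> (\<forall>k. Ck_on k n U f)"

definition smooth_between ::
  "nat \<Rightarrow> (nat \<Rightarrow> real) set \<Rightarrow> nat \<Rightarrow> (nat \<Rightarrow> real) set \<Rightarrow> ((nat \<Rightarrow> real) \<Rightarrow> (nat \<Rightarrow> real)) \<Rightarrow> bool" where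
  "smooth_between m V n U g \<longleftrightarrow> g \<in> V \<rightarrow> U \<and> (\<forall>i<n. smooth_fun_on m V (\<lambda>x. g x i))"


section \<open>Diffeological spaces\<close>

text \<open>\<open>D n U\<close> is the set of plots with domain the open subset \<open>U\<close> of the \<open>n\<close>-dimensional Euclidean
  space. Functions with a given domain are extensional functions, as in \<open>HOL-Library.FuncSet\<close>.\<close>

type_synonym 'a plots = "nat \<Rightarrow> (nat \<Rightarrow> real) set \<Rightarrow> ((nat \<Rightarrow> real) \<Rightarrow> 'a) set"

locale diffeological_space =
  fixes X :: "'a set" and D :: "'a plots"
  assumes plot_domain: "p \<in> D n U \<Longrightarrow> openin (Euclidean_space n) U"
    and plot_fun: "p \<in> D n U \<Longrightarrow> p \<in> U \<rightarrow>\<^sub>E X"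
    and plot_const: "\<lbrakk>openin (Euclidean_space n) U; x \<in> X\<rbrakk> \<Longrightarrow> (\<lambda>u\<in>U. x) \<in> D n U"
    and plot_reparam:
      "\<lbrakk>p \<in> D n U; openin (Euclidean_space m) V; smooth_between m V n U g\<rbrakk> \<Longrightarrow>
        compose V p g \<in> D m V"
    and plot_local:
      "\<lbrakk>\<And>V. V \<in> \<U> \<Longrightarrow> openin (Euclidean_space n) V; p \<in> \<Union>\<U> \<rightarrow>\<^sub>E X;
        \<And>V. V \<in> \<U> \<Longrightarrow> restrict p V \<in> D n V\<rbrakk> \<Longrightarrow> p \<in> D n (\<Union>\<U>)"

definition dsmooth :: "'a set \<Rightarrow> 'a plots \<Rightarrow> 'b set \<Rightarrow> 'b plots \<Rightarrow> ('a \<Rightarrow> 'b) \<Rightarrow> bool" where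
  "dsmooth X D Y E f \<longleftrightarrow> f \<in> X \<rightarrow> Y \<and> (\<forall>n U. \<forall>p\<in>D n U. compose U f p \<in> E n U)"

definition prod_plots :: "'a plots \<Rightarrow> 'b plots \<Rightarrow> ('a \<times> 'b) plots" where
  "prod_plots D E n U =
     {p \<in> extensional U. compose U fst p \<in> D n U \<and> compose U snd p \<in> E n U}"

definition real_plots :: "real plots" where
  "real_plots n U =
     {p \<in> extensional U. openin (Euclidean_space n) U \<and> smooth_fun_on n U p}"


section \<open>Diffeological vector spaces\<close>

definition field_of_reals :: "real ring" where
  "field_of_reals = \<lparr>carrier = UNIV, mult = (*), one = 1, zero = 0, add = (+)\<rparr>"

text \<open>The fields \<open>mult\<close> and \<open>one\<close> inherited from the record of modules carry no meaning here and
  are ignored by morphisms.\<close>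

record 'a dvs = "(real, 'a) module" +
  plots :: "'a plots"

locale diffeological_vector_space =
  module field_of_reals V + diffeological_space "carrier V" "plots V"
  for V :: "'a dvs" +
  assumes add_smooth:
      "dsmooth (carrier V \<times> carrier V) (prod_plots (plots V) (plots V)) (carrier V) (plots V)
        (\<lambda>(x, y). x \<oplus>\<^bsub>V\<^esub> y)"
    and smult_smooth:
      "dsmooth (UNIV \<times> carrier V) (prod_plots real_plots (plots V)) (carrier V) (plots V)
        (\<lambda>(a, x). a \<odot>\<^bsub>V\<^esub> x)"

definition smooth_linear_maps :: "'a dvs \<Rightarrow> 'b dvs \<Rightarrow> ('a \<Rightarrow> 'b) set" where
  "smooth_linear_maps V W =
     {f \<in> carrier V \<rightarrow>\<^sub>E carrier W.
        (\<forall>x\<in>carrier V. \<forall>y\<in>carrier V. f (x \<oplus>\<^bsub>V\<^esub> y) = f x \<oplus>\<^bsub>W\<^esub> f y) \<and>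
        (\<forall>a. \<forall>x\<in>carrier V. f (a \<odot>\<^bsub>V\<^esub> x) = a \<odot>\<^bsub>W\<^esub> f x) \<and>
        dsmooth (carrier V) (plots V) (carrier W) (plots W) f}"

text \<open>The category of diffeological vector spaces whose underlying set is contained in \<open>'u\<close>. An
  arrow is a triple of source, underlying map and target.\<close>

type_synonym 'u dvs_arrow = "'u dvs \<times> ('u \<Rightarrow> 'u) \<times> 'u dvs"

abbreviation underlying_map :: "'u dvs_arrow \<Rightarrow> 'u \<Rightarrow> 'u" where
  "underlying_map a \<equiv> fst (snd a)"

definition DVect :: "('u dvs, 'u dvs_arrow) cat" where
  "DVect =
     \<lparr>Ob = {V. diffeological_vector_space V},
      Ar = {(V, f, W). diffeological_vector_space V \<and> diffeological_vector_space W \<and>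
              f \<in> smooth_linear_maps V W},
      Dom = (\<lambda>(V, f, W). V),
      Cod = (\<lambda>(V, f, W). W),
      Idt = (\<lambda>V. (V, \<lambda>x\<in>carrier V. x, V)),
      Comp = (\<lambda>(W', g, Z) (V, f, W). (V, compose (carrier V) g f, Z))\<rparr>"

text \<open>Cocones whose vertex has its underlying set in a further type \<open>'b\<close>, and the corresponding
  universal property. For \<open>'b = 'u\<close> these are the notions \<open>cocone\<close> and \<open>colimit\<close> in \<open>DVect\<close>; a
  general \<open>'b\<close> removes the size bound that \<open>'u\<close> imposes on the target of a cocone.\<close>

definition dvect_cocone ::
  "('i, 'j) cat \<Rightarrow> ('i \<Rightarrow> 'u dvs) \<Rightarrow> ('j \<Rightarrow> 'u dvs_arrow) \<Rightarrow> 'b dvs \<Rightarrow> ('i \<Rightarrow> 'u \<Rightarrow> 'b) \<Rightarrow> bool" where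
  "dvect_cocone J Fo Fa W \<mu> \<longleftrightarrow>
     diffeological_vector_space W \<and>
     (\<forall>i\<in>Ob J. \<mu> i \<in> smooth_linear_maps (Fo i) W) \<and>
     (\<forall>a\<in>Ar J. compose (carrier (Fo (Dom J a))) (\<mu> (Cod J a)) (underlying_map (Fa a)) = \<mu> (Dom J a))"

definition dvect_universal ::
  "'b itself \<Rightarrow> ('i, 'j) cat \<Rightarrow> ('i \<Rightarrow> 'u dvs) \<Rightarrow> ('j \<Rightarrow> 'u dvs_arrow) \<Rightarrow> 'u dvs \<Rightarrow>
     ('i \<Rightarrow> 'u dvs_arrow) \<Rightarrow> bool" where
  "dvect_universal B J Fo Fa C \<iota> \<longleftrightarrow>
     (\<forall>(W :: 'b dvs) \<mu>. dvect_cocone J Fo Fa W \<mu> \<longrightarrow>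
        (\<exists>!h. h \<in> smooth_linear_maps C W \<and>
              (\<forall>i\<in>Ob J. compose (carrier (Fo i)) h (underlying_map (\<iota> i)) = \<mu> i)))"

end

theory Submission
  imports Defs
begin

text \<open>The colimit of a diagram is the vector space of formal sums of vectors of the diagram, modulo
  the relations imposed by its arrows. Its diffeology is the intersection of all vector space
  diffeologies for which the injections are smooth. The linear map induced by a cocone is smooth,
  because the pullback along it of the diffeology of the vertex is one of these. Finite sequences
  over an infinite universe can be encoded in the universe, and over a finite universe all
  vector spaces are zero, so the colimit has a copy in the universe.\<close>

section \<open>Diffeological vector spaces\<close>

text \<open>Scalars act inside each letter of a formal sum, so formal sums carry no real
  coefficients; this is why finite sequences of pairs of an index and a vector suffice and the
  universe need not contain a copy of the reals. The intersection spares any explicit description of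
  the generated plots. It works through two facts: vector space diffeologies on a fixed module are
  closed under intersection, and they pull back along linear maps. The second half of the theorem
  concerns targets whose underlying type \<open>'b\<close> may be larger than the universe. A
  colimit in \<open>DVect\<close> is tested only against targets in \<open>'u\<close>, so this
  property does not follow from its definition. It is proved for the constructed colimit, where the
  type of the target is arbitrary, and then carried to any other colimit by the comparison maps,
  which live inside \<open>'u\<close>.\<close>

lemma cring_field_of_reals: "cring field_of_reals"
proof (rule cringI)
  show "abelian_group field_of_reals"
  proof (rule abelian_groupI)
    show "\<exists>y\<in>carrier field_of_reals. y \<oplus>\<^bsub>field_of_reals\<^esub> x = \<zero>\<^bsub>field_of_reals\<^esub>" for x
      by (rule bexI[of _ "- x"]) (auto simp: field_of_reals_def)
  qed (auto simp: field_of_reals_def)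
  show "comm_monoid field_of_reals"
    by (rule comm_monoidI) (auto simp: field_of_reals_def)
qed (auto simp: field_of_reals_def algebra_simps)

text \<open>A plot of the product is the same as a pair of plots; extensionality ensures that the
  components of the paired map are the given plots themselves. In this form smoothness of the
  operations is a closure property under pointwise operations.\<close>

lemma dsmooth_prod_iff:
  assumes "\<And>n U. D n U \<subseteq> extensional U" and "\<And>n U. E n U \<subseteq> extensional U"
  shows "dsmooth (X \<times> Y) (prod_plots D E) Z F (\<lambda>(x, y). f x y) \<longleftrightarrow>
    (\<forall>x\<in>X. \<forall>y\<in>Y. f x y \<in> Z) \<and>
    (\<forall>n U. \<forall>p\<in>D n U. \<forall>r\<in>E n U. (\<lambda>u\<in>U. f (p u) (r u)) \<in> F n U)"
    (is "?L \<longleftrightarrow> ?R")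
proof
  assume L: ?L
  have "(\<lambda>u\<in>U. f (p u) (r u)) \<in> F n U" if "p \<in> D n U" "r \<in> E n U" for n U p r
  proof -
    let ?s = "\<lambda>u\<in>U. (p u, r u)"
    have "compose U fst ?s = p" "compose U snd ?s = r"
      using that assms[of n U] by (auto intro!: extensionalityI[of _ U] simp: compose_def)
    then have "?s \<in> prod_plots D E n U"
      using that by (simp add: prod_plots_def)
    then have "compose U (\<lambda>(x, y). f x y) ?s \<in> F n U"
      using L by (simp add: dsmooth_def)
    also have "compose U (\<lambda>(x, y). f x y) ?s = (\<lambda>u\<in>U. f (p u) (r u))"
      by (auto simp: compose_def)
    finally show ?thesis .
  qed
  moreover have "f x y \<in> Z" if "x \<in> X" "y \<in> Y" for x y
    using L that by (auto simp: dsmooth_def dest!: funcset_mem[of _ _ _ "(x, y)"])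
  ultimately show ?R by blast
next
  assume R: ?R
  have "compose U (\<lambda>(x, y). f x y) s \<in> F n U" if "s \<in> prod_plots D E n U" for n U s
  proof -
    have "compose U (\<lambda>(x, y). f x y) s =
        (\<lambda>u\<in>U. f (compose U fst s u) (compose U snd s u))"
      by (auto simp: compose_def split_beta)
    with R that show ?thesis by (simp add: prod_plots_def)
  qed
  with R show ?L by (auto simp: dsmooth_def)
qed

lemma diffeological_vector_space_iff:
  "diffeological_vector_space V \<longleftrightarrow>
    module field_of_reals V \<and> diffeological_space (carrier V) (plots V) \<and>
    (\<forall>n U. \<forall>p\<in>plots V n U. \<forall>r\<in>plots V n U. (\<lambda>u\<in>U. p u \<oplus>\<^bsub>V\<^esub> r u) \<in> plots V n U) \<and>
    (\<forall>n U. \<forall>a\<in>real_plots n U. \<forall>p\<in>plots V n U. (\<lambda>u\<in>U. a u \<odot>\<^bsub>V\<^esub> p u) \<in> plots V n U)"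
proof -
  have "\<And>n U. real_plots n U \<subseteq> extensional U"
    by (auto simp: real_plots_def)
  moreover have "plots V n U \<subseteq> extensional U" if "diffeological_space (carrier V) (plots V)" for n U
    using diffeological_space.plot_fun[OF that] by (auto simp: PiE_def)
  moreover have "x \<oplus>\<^bsub>V\<^esub> y \<in> carrier V"
    if "module field_of_reals V" "x \<in> carrier V" "y \<in> carrier V" for x y
    using that by (simp add: module.axioms(2) abelian_group.axioms(1) abelian_monoid.a_closed)
  moreover have "a \<odot>\<^bsub>V\<^esub> x \<in> carrier V"
    if "module field_of_reals V" "x \<in> carrier V" for a x
    using module.smult_closed[OF that(1), of a x] that by (simp add: field_of_reals_def)
  ultimately show ?thesis
    unfolding diffeological_vector_space_def diffeological_vector_space_axioms_def
    by (auto simp: dsmooth_prod_iff)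
qed

context diffeological_vector_space
begin

lemma scale_closed: "x \<in> carrier V \<Longrightarrow> a \<odot>\<^bsub>V\<^esub> x \<in> carrier V"
  and scale_add_left: "x \<in> carrier V \<Longrightarrow> (a + b) \<odot>\<^bsub>V\<^esub> x = a \<odot>\<^bsub>V\<^esub> x \<oplus>\<^bsub>V\<^esub> b \<odot>\<^bsub>V\<^esub> x"
  and scale_add_right: "x \<in> carrier V \<Longrightarrow> y \<in> carrier V \<Longrightarrow>
    a \<odot>\<^bsub>V\<^esub> (x \<oplus>\<^bsub>V\<^esub> y) = a \<odot>\<^bsub>V\<^esub> x \<oplus>\<^bsub>V\<^esub> a \<odot>\<^bsub>V\<^esub> y"
  and scale_scale: "x \<in> carrier V \<Longrightarrow> a \<odot>\<^bsub>V\<^esub> (b \<odot>\<^bsub>V\<^esub> x) = (a * b) \<odot>\<^bsub>V\<^esub> x"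
  and scale_one: "x \<in> carrier V \<Longrightarrow> 1 \<odot>\<^bsub>V\<^esub> x = x"
  and scale_zero_left: "x \<in> carrier V \<Longrightarrow> 0 \<odot>\<^bsub>V\<^esub> x = \<zero>\<^bsub>V\<^esub>"
  and scale_zero_right: "a \<odot>\<^bsub>V\<^esub> \<zero>\<^bsub>V\<^esub> = \<zero>\<^bsub>V\<^esub>"
  using smult_closed[of a x] smult_l_distr[of a b x] smult_r_distr[of a x y]
    smult_assoc1[of a b x] smult_one[of x] smult_l_null[of x] smult_r_null[of a]
  by (simp_all add: field_of_reals_def)

text \<open>Infinitely many scalars and finitely many vectors force two distinct scalars to agree on
  \<open>x\<close>; their difference annihilates \<open>x\<close> and is invertible.\<close>

lemma carrier_finite_imp_zero:
  assumes "finite (carrier V)" and x: "x \<in> carrier V"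
  shows "x = \<zero>\<^bsub>V\<^esub>"
proof -
  have "range (\<lambda>a::real. a \<odot>\<^bsub>V\<^esub> x) \<subseteq> carrier V"
    using x by (auto simp: scale_closed)
  then have "\<not> inj (\<lambda>a::real. a \<odot>\<^bsub>V\<^esub> x)"
    using assms(1) finite_imageD infinite_UNIV_char_0 finite_subset by blast
  then obtain a b :: real where ab: "a \<noteq> b" "a \<odot>\<^bsub>V\<^esub> x = b \<odot>\<^bsub>V\<^esub> x"
    by (auto simp: inj_def)
  have "(a - b) \<odot>\<^bsub>V\<^esub> x = a \<odot>\<^bsub>V\<^esub> x \<oplus>\<^bsub>V\<^esub> (- b) \<odot>\<^bsub>V\<^esub> x"
    using scale_add_left[OF x, of a "- b"] by simp
  also have "\<dots> = (b + - b) \<odot>\<^bsub>V\<^esub> x"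
    using scale_add_left[OF x, of b "- b"] ab by simp
  finally have *: "(a - b) \<odot>\<^bsub>V\<^esub> x = \<zero>\<^bsub>V\<^esub>"
    by (simp add: scale_zero_left x)
  have "x = (inverse (a - b) * (a - b)) \<odot>\<^bsub>V\<^esub> x"
    using ab x by (simp add: scale_one)
  also have "\<dots> = \<zero>\<^bsub>V\<^esub>"
    unfolding scale_scale[OF x, symmetric] * by (rule scale_zero_right)
  finally show ?thesis .
qed

end

text \<open>\<open>module\<close> is a predicate on the whole record, so a module with other plots
  is formally a different one. One implication gives both, since a second update restores the
  original plots.\<close>

lemma module_plots_update:
  "module field_of_reals (V\<lparr>plots := E\<rparr>) \<longleftrightarrow> module field_of_reals (V :: 'a dvs)"
proof -
  have *: "module field_of_reals (W\<lparr>plots := F\<rparr>)"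
    if W: "module field_of_reals W" for W :: "'a dvs" and F
  proof -
    interpret module field_of_reals W by (rule W)
    show ?thesis
    proof (rule moduleI)
      show "abelian_group (W\<lparr>plots := F\<rparr>)"
        by (rule abelian_groupI)
          (auto intro: M.a_assoc M.a_comm M.l_neg M.add.inv_closed)
    qed (auto intro: cring_field_of_reals smult_l_distr smult_r_distr smult_assoc1)
  qed
  show ?thesis
    using *[of V E] *[of "V\<lparr>plots := E\<rparr>" "plots V"] by auto
qed

lemma diffeological_vector_space_plots_updateI:
  assumes "module field_of_reals V" and "diffeological_space (carrier V) D"
    and "\<And>p r n U. \<lbrakk>p \<in> D n U; r \<in> D n U\<rbrakk> \<Longrightarrow> (\<lambda>u\<in>U. p u \<oplus>\<^bsub>V\<^esub> r u) \<in> D n U"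
    and "\<And>a p n U. \<lbrakk>a \<in> real_plots n U; p \<in> D n U\<rbrakk> \<Longrightarrow> (\<lambda>u\<in>U. a u \<odot>\<^bsub>V\<^esub> p u) \<in> D n U"
  shows "diffeological_vector_space (V\<lparr>plots := D\<rparr>)"
  using assms by (simp add: diffeological_vector_space_iff module_plots_update)

text \<open>Apart from the domain and codomain of plots, every axiom says that certain maps are
  plots if certain others are, and such conditions survive intersections. Domain and codomain are
  imposed explicitly, so the empty family yields the coarse diffeology.\<close>

lemma diffeological_vector_space_Inter:
  fixes V :: "'a dvs"
  assumes V: "module field_of_reals V"
    and \<E>: "\<And>E. E \<in> \<E> \<Longrightarrow> diffeological_vector_space (V\<lparr>plots := E\<rparr>)"
  shows "diffeological_vector_space (V\<lparr>plots := \<lambda>n U. {p \<in> U \<rightarrow>\<^sub>E carrier V.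
    openin (Euclidean_space n) U \<and> (\<forall>E\<in>\<E>. p \<in> E n U)}\<rparr>)"
    (is "diffeological_vector_space (V\<lparr>plots := ?D\<rparr>)")
proof -
  interpret module field_of_reals V by (rule V)
  have sp: "diffeological_space (carrier V) E" if "E \<in> \<E>" for E
    using \<E>[OF that] by (simp add: diffeological_vector_space_iff)
  have "diffeological_space (carrier V) ?D"
  proof
    show "compose W p g \<in> ?D m W"
      if "p \<in> ?D n U" "openin (Euclidean_space m) W" "smooth_between m W n U g"
      for p n U m W g
      using that diffeological_space.plot_reparam[OF sp]
      by (auto simp: compose_def smooth_between_def)
    show "p \<in> ?D n (\<Union>\<U>)"
      if "\<And>W. W \<in> \<U> \<Longrightarrow> openin (Euclidean_space n) W" "p \<in> \<Union>\<U> \<rightarrow>\<^sub>E carrier V"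
        "\<And>W. W \<in> \<U> \<Longrightarrow> restrict p W \<in> ?D n W" for \<U> n p
      using that diffeological_space.plot_local[OF sp] by auto
  qed (auto intro: diffeological_space.plot_const[OF sp])
  moreover have "(\<lambda>u\<in>U. p u \<oplus>\<^bsub>V\<^esub> r u) \<in> ?D n U"
    if "p \<in> ?D n U" "r \<in> ?D n U" for p r n U
    using that \<E> by (auto simp: diffeological_vector_space_iff PiE_iff)
  moreover have "(\<lambda>u\<in>U. a u \<odot>\<^bsub>V\<^esub> p u) \<in> ?D n U"
    if "a \<in> real_plots n U" "p \<in> ?D n U" for a p n U
    using that \<E> smult_closed by (auto simp: diffeological_vector_space_iff PiE_iff field_of_reals_def)
  ultimately show ?thesis
    by (rule diffeological_vector_space_plots_updateI[OF V])
qed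

text \<open>Composition with \<open>h\<close> commutes with reparametrization and restriction, and
  by linearity with pointwise sums and multiples, so each closure condition is inherited from
  \<open>W\<close>.\<close>

lemma diffeological_vector_space_pullback:
  fixes V :: "'a dvs" and W :: "'b dvs"
  assumes V: "module field_of_reals V" and W: "diffeological_vector_space W"
    and h: "h \<in> carrier V \<rightarrow> carrier W"
    and h_add: "\<And>x y. \<lbrakk>x \<in> carrier V; y \<in> carrier V\<rbrakk> \<Longrightarrow> h (x \<oplus>\<^bsub>V\<^esub> y) = h x \<oplus>\<^bsub>W\<^esub> h y"
    and h_smult: "\<And>a x. x \<in> carrier V \<Longrightarrow> h (a \<odot>\<^bsub>V\<^esub> x) = a \<odot>\<^bsub>W\<^esub> h x"
  shows "diffeological_vector_space (V\<lparr>plots := \<lambda>n U. {p \<in> U \<rightarrow>\<^sub>E carrier V.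
    openin (Euclidean_space n) U \<and> compose U h p \<in> plots W n U}\<rparr>)"
    (is "diffeological_vector_space (V\<lparr>plots := ?D\<rparr>)")
proof -
  interpret module field_of_reals V by (rule V)
  interpret W: diffeological_vector_space W by (rule W)
  have "diffeological_space (carrier V) ?D"
  proof
    show "compose Y p g \<in> ?D m Y"
      if p: "p \<in> ?D n U" and Y: "openin (Euclidean_space m) Y" and g: "smooth_between m Y n U g"
      for p n U m Y g
    proof -
      have gY: "g u \<in> U" if "u \<in> Y" for u
        using g that by (auto simp: smooth_between_def)
      then have "compose Y h (compose Y p g) = compose Y (compose U h p) g"
        by (auto simp: compose_def)
      with W.plot_reparam[OF _ Y g, of "compose U h p"] p Y gY show ?thesis
        by (auto simp: compose_def)
    qed
    show "p \<in> ?D n (\<Union>\<U>)"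
      if \<U>: "\<And>Y. Y \<in> \<U> \<Longrightarrow> openin (Euclidean_space n) Y" and p: "p \<in> \<Union>\<U> \<rightarrow>\<^sub>E carrier V"
        and pY: "\<And>Y. Y \<in> \<U> \<Longrightarrow> restrict p Y \<in> ?D n Y" for \<U> n p
    proof -
      have "compose (\<Union>\<U>) h p \<in> plots W n (\<Union>\<U>)"
      proof (rule W.plot_local)
        show "restrict (compose (\<Union>\<U>) h p) Y \<in> plots W n Y" if "Y \<in> \<U>" for Y
        proof -
          have "restrict (compose (\<Union>\<U>) h p) Y = compose Y h (restrict p Y)"
            using that by (auto simp: compose_def restrict_def)
          with pY[OF that] show ?thesis by simp
        qed
        show "compose (\<Union>\<U>) h p \<in> \<Union>\<U> \<rightarrow>\<^sub>E carrier W"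
          using p h by (auto simp: compose_def PiE_iff Pi_iff)
      qed (rule \<U>)
      with \<U> p show ?thesis by auto
    qed
    show "(\<lambda>u\<in>U. x) \<in> ?D n U" if "openin (Euclidean_space n) U" "x \<in> carrier V" for n U x
    proof -
      have "compose U h (\<lambda>u\<in>U. x) = (\<lambda>u\<in>U. h x)"
        by (auto simp: compose_def)
      with that h W.plot_const[OF that(1), of "h x"] show ?thesis by auto
    qed
  qed auto
  moreover have "(\<lambda>u\<in>U. p u \<oplus>\<^bsub>V\<^esub> r u) \<in> ?D n U"
    if pr: "p \<in> ?D n U" "r \<in> ?D n U" for p r n U
  proof -
    have "compose U h (\<lambda>u\<in>U. p u \<oplus>\<^bsub>V\<^esub> r u) =
        (\<lambda>u\<in>U. compose U h p u \<oplus>\<^bsub>W\<^esub> compose U h r u)"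
      using pr by (auto simp: compose_def h_add PiE_iff)
    moreover have "\<dots> \<in> plots W n U"
      using pr W by (simp add: diffeological_vector_space_iff)
    ultimately show ?thesis
      using pr by (auto simp: PiE_iff)
  qed
  moreover have "(\<lambda>u\<in>U. a u \<odot>\<^bsub>V\<^esub> p u) \<in> ?D n U"
    if ap: "a \<in> real_plots n U" "p \<in> ?D n U" for a p n U
  proof -
    have "compose U h (\<lambda>u\<in>U. a u \<odot>\<^bsub>V\<^esub> p u) = (\<lambda>u\<in>U. a u \<odot>\<^bsub>W\<^esub> compose U h p u)"
      using ap by (auto simp: compose_def h_smult PiE_iff)
    moreover have "\<dots> \<in> plots W n U"
      using ap W by (simp add: diffeological_vector_space_iff)
    ultimately show ?thesis
      using ap smult_closed by (auto simp: PiE_iff field_of_reals_def)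
  qed
  ultimately show ?thesis
    by (rule diffeological_vector_space_plots_updateI[OF V])
qed


section \<open>The category of diffeological vector spaces\<close>

lemma smooth_linear_maps_id:
  assumes "diffeological_vector_space V"
  shows "(\<lambda>x\<in>carrier V. x) \<in> smooth_linear_maps V V"
proof -
  interpret diffeological_vector_space V by (rule assms)
  have "compose U (\<lambda>x\<in>carrier V. x) p = p" if "p \<in> plots V n U" for p n U
    using plot_fun[OF that] by (auto simp: compose_def fun_eq_iff PiE_iff extensional_def)
  then show ?thesis
    by (auto simp: smooth_linear_maps_def dsmooth_def scale_closed)
qed

lemma smooth_linear_maps_compose:
  assumes V: "diffeological_vector_space V"
    and f: "f \<in> smooth_linear_maps V W" and g: "g \<in> smooth_linear_maps W Z"
  shows "compose (carrier V) g f \<in> smooth_linear_maps V Z"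
proof -
  interpret diffeological_vector_space V by (rule V)
  have fW: "f x \<in> carrier W" if "x \<in> carrier V" for x
    using f that by (auto simp: smooth_linear_maps_def)
  have gZ: "g x \<in> carrier Z" if "x \<in> carrier W" for x
    using g that by (auto simp: smooth_linear_maps_def)
  have "compose U (compose (carrier V) g f) p \<in> plots Z n U" if "p \<in> plots V n U" for p n U
  proof -
    have "compose U (compose (carrier V) g f) p = compose U g (compose U f p)"
      using plot_fun[OF that] by (auto simp: compose_def fun_eq_iff PiE_iff)
    with f g that show ?thesis
      by (simp add: smooth_linear_maps_def dsmooth_def)
  qed
  moreover have "compose (carrier V) g f \<in> carrier V \<rightarrow>\<^sub>E carrier Z"
    using fW gZ by (auto simp: compose_def)
  ultimately show ?thesis
    using f g fW by (auto simp: smooth_linear_maps_def dsmooth_def compose_def scale_closed)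
qed

lemma Hom_DVect_iff:
  "a \<in> Hom DVect V W \<longleftrightarrow> diffeological_vector_space V \<and> diffeological_vector_space W \<and>
    (\<exists>f\<in>smooth_linear_maps V W. a = (V, f, W))"
  by (cases a) (auto simp: Hom_def DVect_def)

lemma Ob_DVect [simp]: "V \<in> Ob DVect \<longleftrightarrow> diffeological_vector_space V"
  by (simp add: DVect_def)

lemma Comp_DVect [simp]: "Comp DVect (W', g, Z) (V, f, W) = (V, compose (carrier V) g f, Z)"
  by (simp add: DVect_def)

lemma smooth_linear_mapsD:
  assumes "f \<in> smooth_linear_maps V W"
  shows "f \<in> carrier V \<rightarrow> carrier W" and "f \<in> extensional (carrier V)"
    and "x \<in> carrier V \<Longrightarrow> f x \<in> carrier W"
    and "\<lbrakk>x \<in> carrier V; y \<in> carrier V\<rbrakk> \<Longrightarrow> f (x \<oplus>\<^bsub>V\<^esub> y) = f x \<oplus>\<^bsub>W\<^esub> f y"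
    and "x \<in> carrier V \<Longrightarrow> f (a \<odot>\<^bsub>V\<^esub> x) = a \<odot>\<^bsub>W\<^esub> f x"
    and "p \<in> plots V n U \<Longrightarrow> compose U f p \<in> plots W n U"
  using assms by (auto simp: smooth_linear_maps_def dsmooth_def PiE_def)

text \<open>Preservation of zero is not among the conditions of \<open>smooth_linear_maps\<close>;
  it follows by writing zero as the multiple of zero by the scalar 0.\<close>

lemma smooth_linear_maps_zero:
  assumes V: "diffeological_vector_space V" and W: "diffeological_vector_space W"
    and f: "f \<in> smooth_linear_maps V W"
  shows "f \<zero>\<^bsub>V\<^esub> = \<zero>\<^bsub>W\<^esub>"
proof -
  interpret V: diffeological_vector_space V by (rule V)
  interpret W: diffeological_vector_space W by (rule W)
  show ?thesis
    using smooth_linear_mapsD(3)[OF f V.zero_closed] smooth_linear_mapsD(5)[OF f V.zero_closed, of 0]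
    by (simp add: V.scale_zero_right W.scale_zero_left)
qed

lemma category_DVect: "category DVect"
proof
  show "Idt DVect V \<in> Hom DVect V V" if "V \<in> Ob DVect" for V :: "'a dvs"
    using that smooth_linear_maps_id[of V] by (auto simp: Hom_DVect_iff) (auto simp: DVect_def)
  show "Comp DVect g f \<in> Hom DVect x z" if "f \<in> Hom DVect x y" "g \<in> Hom DVect y z"
    for f g and x y z :: "'a dvs"
    using that smooth_linear_maps_compose[of x _ y _ z] by (auto simp: Hom_DVect_iff)
  show "Comp DVect (Idt DVect y) f = f" if "f \<in> Hom DVect x y" for f and x y :: "'a dvs"
    using that Id_compose[OF smooth_linear_mapsD(1,2)]
    by (auto simp: Hom_DVect_iff) (auto simp: DVect_def)
  show "Comp DVect f (Idt DVect x) = f" if "f \<in> Hom DVect x y" for f and x y :: "'a dvs"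
    using that compose_Id[OF smooth_linear_mapsD(1,2)]
    by (auto simp: Hom_DVect_iff) (auto simp: DVect_def)
  show "Comp DVect h (Comp DVect g f) = Comp DVect (Comp DVect h g) f"
    if "f \<in> Hom DVect w x" "g \<in> Hom DVect x y" "h \<in> Hom DVect y z"
    for f g h and w x y z :: "'a dvs"
  proof -
    obtain f' g' h' where "f' \<in> smooth_linear_maps w x"
      "f = (w, f', x)" "g = (x, g', y)" "h = (y, h', z)"
      using \<open>f \<in> _\<close> \<open>g \<in> _\<close> \<open>h \<in> _\<close> unfolding Hom_DVect_iff by blast
    then show ?thesis
      using compose_assoc[OF smooth_linear_mapsD(1), of f' w x h' g'] by simp
  qed
qed (auto simp: DVect_def)

lemma ex1_Hom_DVect_iff:
  assumes "diffeological_vector_space V" and "diffeological_vector_space W"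
  shows "(\<exists>!h. h \<in> Hom DVect V W \<and> P h) \<longleftrightarrow>
    (\<exists>!f. f \<in> smooth_linear_maps V W \<and> P (V, f, W))"
  using assms by (simp add: Ex1_def Hom_DVect_iff split_paired_Ex split_paired_All)


section \<open>Colimits of diffeological vector spaces\<close>

locale dvect_diagram = cat_functor J DVect Fo Fa
  for J :: "('i, 'j) cat" and Fo :: "'i \<Rightarrow> 'u dvs" and Fa :: "'j \<Rightarrow> 'u dvs_arrow"
begin

lemma Fo_dvs: "i \<in> Ob J \<Longrightarrow> diffeological_vector_space (Fo i)"
  using Fo_Ob by simp

lemma Fa_arrow:
  assumes "a \<in> Ar J"
  shows "fst (Fa a) = Fo (Dom J a)" and "snd (snd (Fa a)) = Fo (Cod J a)"
    and "underlying_map (Fa a) \<in> smooth_linear_maps (Fo (Dom J a)) (Fo (Cod J a))"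
  using Fa_Hom[of a "Dom J a" "Cod J a"] assms by (auto simp: Hom_DVect_iff Hom_def[of J])

lemma cocone_DVect_iff:
  "cocone J DVect Fo Fa W \<mu> \<longleftrightarrow>
    dvect_cocone J Fo Fa W (\<lambda>i. underlying_map (\<mu> i)) \<and>
    (\<forall>i\<in>Ob J. fst (\<mu> i) = Fo i \<and> snd (snd (\<mu> i)) = W)"
proof -
  have Hom: "\<mu> i \<in> Hom DVect (Fo i) W \<longleftrightarrow>
      underlying_map (\<mu> i) \<in> smooth_linear_maps (Fo i) W \<and>
      fst (\<mu> i) = Fo i \<and> snd (snd (\<mu> i)) = W"
    if "diffeological_vector_space W" "i \<in> Ob J" for i
    using that Fo_dvs[of i] by (cases "\<mu> i") (auto simp: Hom_DVect_iff)
  have Comp: "Comp DVect (\<mu> (Cod J a)) (Fa a) = \<mu> (Dom J a) \<longleftrightarrow>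
      compose (carrier (Fo (Dom J a))) (underlying_map (\<mu> (Cod J a))) (underlying_map (Fa a)) =
        underlying_map (\<mu> (Dom J a))"
    if "\<forall>i\<in>Ob J. fst (\<mu> i) = Fo i \<and> snd (snd (\<mu> i)) = W" "a \<in> Ar J" for a
    using that(1)[rule_format, of "Dom J a"] that(1)[rule_format, of "Cod J a"]
      that(2) Fa_arrow(1)[of a] J.Dom_closed[of a] J.Cod_closed[of a]
    by (cases "\<mu> (Cod J a)"; cases "\<mu> (Dom J a)"; cases "Fa a") auto
  show ?thesis
    unfolding cocone_def dvect_cocone_def using Hom Comp by auto
qed

text \<open>An arrow is determined by its underlying map once its ends are fixed. This makes the
  universal property in \<open>DVect\<close> the case \<open>'b = 'u\<close> of
  \<open>dvect_universal\<close>, so that one argument can treat all target types.\<close>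

lemma colimit_DVect_iff:
  "colimit J DVect Fo Fa C \<iota> \<longleftrightarrow>
    cocone J DVect Fo Fa C \<iota> \<and> dvect_universal TYPE('u) J Fo Fa C \<iota>"
proof (cases "cocone J DVect Fo Fa C \<iota>")
  case True
  then have C: "diffeological_vector_space C"
    and \<iota>: "\<And>i. i \<in> Ob J \<Longrightarrow> fst (\<iota> i) = Fo i \<and> snd (snd (\<iota> i)) = C"
    unfolding cocone_DVect_iff by (auto simp: dvect_cocone_def)
  let ?U = "\<lambda>W \<mu>. \<exists>!h. h \<in> smooth_linear_maps C W \<and>
    (\<forall>i\<in>Ob J. compose (carrier (Fo i)) h (underlying_map (\<iota> i)) = \<mu> i)"
  have ex1: "(\<exists>!h. h \<in> Hom DVect C W \<and> (\<forall>i\<in>Ob J. Comp DVect h (\<iota> i) = \<mu> i)) \<longleftrightarrow>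
      ?U W (\<lambda>i. underlying_map (\<mu> i))"
    if \<mu>: "cocone J DVect Fo Fa W \<mu>" for W \<mu>
  proof -
    have "diffeological_vector_space W"
      and *: "\<And>i. i \<in> Ob J \<Longrightarrow> fst (\<mu> i) = Fo i \<and> snd (snd (\<mu> i)) = W"
      using \<mu> unfolding cocone_DVect_iff by (auto simp: dvect_cocone_def)
    moreover have "Comp DVect (C, h, W) (\<iota> i) = \<mu> i \<longleftrightarrow>
        compose (carrier (Fo i)) h (underlying_map (\<iota> i)) = underlying_map (\<mu> i)"
      if "i \<in> Ob J" for i h
      using \<iota>[OF that] *[OF that] by (cases "\<iota> i"; cases "\<mu> i") auto
    ultimately show ?thesis
      using C by (simp add: ex1_Hom_DVect_iff cong: conj_cong)
  qed
  have "(\<forall>(W :: 'u dvs) \<mu>. cocone J DVect Fo Fa W \<mu> \<longrightarrow> ?U W (\<lambda>i. underlying_map (\<mu> i))) \<longleftrightarrow>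
      (\<forall>(W :: 'u dvs) \<mu>. dvect_cocone J Fo Fa W \<mu> \<longrightarrow> ?U W \<mu>)" (is "?L \<longleftrightarrow> ?R")
  proof
    assume L: ?L
    show ?R
    proof (intro allI impI)
      fix W :: "'u dvs" and \<mu>
      assume "dvect_cocone J Fo Fa W \<mu>"
      then have "cocone J DVect Fo Fa W (\<lambda>i. (Fo i, \<mu> i, W))"
        by (simp add: cocone_DVect_iff)
      from L[rule_format, OF this] show "?U W \<mu>" by simp
    qed
  next
    assume ?R
    then show ?L unfolding cocone_DVect_iff by blast
  qed
  with True ex1 show ?thesis
    by (simp add: colimit_def dvect_universal_def)
qed (simp add: colimit_def)

text \<open>The comparison maps \<open>f\<close> from \<open>C\<close> to \<open>C'\<close> and
  \<open>g\<close> back exist by the universal properties within \<open>'u\<close>. A factorization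
  \<open>h\<close> through \<open>C'\<close> gives \<open>h\<close> after \<open>f\<close> through
  \<open>C\<close>. Conversely, if \<open>k\<close> factors through \<open>C\<close>, then
  \<open>k\<close> after \<open>g\<close> equals \<open>h\<close> by uniqueness for
  \<open>C'\<close>, and composing with \<open>f\<close> recovers \<open>k\<close> because
  \<open>g\<close> after \<open>f\<close> is the identity.\<close>

lemma dvect_universal_transport:
  assumes C: "dvect_cocone J Fo Fa C (\<lambda>i. underlying_map (\<iota> i))"
    and uC: "dvect_universal TYPE('u) J Fo Fa C \<iota>"
    and C': "dvect_cocone J Fo Fa C' (\<lambda>i. underlying_map (\<iota>' i))"
    and uC': "dvect_universal TYPE('u) J Fo Fa C' \<iota>'"
    and u: "dvect_universal TYPE('b) J Fo Fa C' \<iota>'"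
  shows "dvect_universal TYPE('b) J Fo Fa C \<iota>"
proof -
  obtain f where f: "f \<in> smooth_linear_maps C C'"
    and f\<iota>: "\<And>i. i \<in> Ob J \<Longrightarrow>
      compose (carrier (Fo i)) f (underlying_map (\<iota> i)) = underlying_map (\<iota>' i)"
    using uC C' unfolding dvect_universal_def by blast
  obtain g where g: "g \<in> smooth_linear_maps C' C"
    and g\<iota>: "\<And>i. i \<in> Ob J \<Longrightarrow>
      compose (carrier (Fo i)) g (underlying_map (\<iota>' i)) = underlying_map (\<iota> i)"
    using uC' C unfolding dvect_universal_def by blast
  have dvs: "diffeological_vector_space C" "diffeological_vector_space C'"
    using C C' by (auto simp: dvect_cocone_def)
  have \<iota>: "underlying_map (\<iota> i) \<in> smooth_linear_maps (Fo i) C"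
    and \<iota>': "underlying_map (\<iota>' i) \<in> smooth_linear_maps (Fo i) C'" if "i \<in> Ob J" for i
    using C C' that by (auto simp: dvect_cocone_def)
  \<comment> \<open>Both sides factor the cocone of \<open>C\<close> through itself, so uniqueness
    in \<open>uC\<close> identifies them.\<close>
  have gf: "compose (carrier C) g f = (\<lambda>x\<in>carrier C. x)"
  proof -
    have "compose (carrier (Fo i)) (compose (carrier C) g f) (underlying_map (\<iota> i)) =
        underlying_map (\<iota> i)" if "i \<in> Ob J" for i
      using compose_assoc[OF smooth_linear_mapsD(1)[OF \<iota>[OF that]], of g f] that
      by (simp add: f\<iota> g\<iota>)
    moreover have "compose (carrier (Fo i)) (\<lambda>x\<in>carrier C. x) (underlying_map (\<iota> i)) =
        underlying_map (\<iota> i)" if "i \<in> Ob J" for i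
      using smooth_linear_mapsD(1,2)[OF \<iota>[OF that]] by (rule Id_compose)
    moreover have "compose (carrier C) g f \<in> smooth_linear_maps C C"
      "(\<lambda>x\<in>carrier C. x) \<in> smooth_linear_maps C C"
      using smooth_linear_maps_compose[OF dvs(1) f g] smooth_linear_maps_id[OF dvs(1)] by auto
    ultimately show ?thesis
      using uC C unfolding dvect_universal_def by blast
  qed
  show ?thesis
    unfolding dvect_universal_def
  proof (intro allI impI)
    fix W :: "'b dvs" and \<mu>
    assume \<mu>: "dvect_cocone J Fo Fa W \<mu>"
    let ?P = "\<lambda>k. k \<in> smooth_linear_maps C' W \<and>
      (\<forall>i\<in>Ob J. compose (carrier (Fo i)) k (underlying_map (\<iota>' i)) = \<mu> i)"
    have ex1: "\<exists>!k. ?P k"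
      using u \<mu> by (simp add: dvect_universal_def)
    then obtain h where P: "?P h" by (rule ex1E)
    then have h: "h \<in> smooth_linear_maps C' W"
      and h\<iota>: "\<And>i. i \<in> Ob J \<Longrightarrow>
        compose (carrier (Fo i)) h (underlying_map (\<iota>' i)) = \<mu> i"
      by simp_all
    have h_unique: "k = h" if "?P k" for k
      using Uniq_D[of ?P k h] ex1 that P unfolding ex1_iff_ex_Uniq by blast
    show "\<exists>!k. k \<in> smooth_linear_maps C W \<and>
        (\<forall>i\<in>Ob J. compose (carrier (Fo i)) k (underlying_map (\<iota> i)) = \<mu> i)"
    proof (intro ex1I conjI ballI)
      show "compose (carrier C) h f \<in> smooth_linear_maps C W"
        using dvs(1) f h by (rule smooth_linear_maps_compose)
      show "compose (carrier (Fo i)) (compose (carrier C) h f) (underlying_map (\<iota> i)) = \<mu> i"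
        if "i \<in> Ob J" for i
        using compose_assoc[OF smooth_linear_mapsD(1)[OF \<iota>[OF that]], of h f] that
        by (simp add: f\<iota> h\<iota>)
      fix k assume k: "k \<in> smooth_linear_maps C W \<and>
        (\<forall>i\<in>Ob J. compose (carrier (Fo i)) k (underlying_map (\<iota> i)) = \<mu> i)"
      have "compose (carrier C') k g = h"
      proof (intro h_unique conjI ballI)
        show "compose (carrier C') k g \<in> smooth_linear_maps C' W"
          using smooth_linear_maps_compose[OF dvs(2) g] k by blast
        show "compose (carrier (Fo i)) (compose (carrier C') k g) (underlying_map (\<iota>' i)) = \<mu> i"
          if "i \<in> Ob J" for i
          using compose_assoc[OF smooth_linear_mapsD(1)[OF \<iota>'[OF that]], of k g] that k
          by (simp add: g\<iota>)
      qed
      moreover have "compose (carrier C) (compose (carrier C') k g) f =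
          compose (carrier C) k (compose (carrier C) g f)"
        using compose_assoc[OF smooth_linear_mapsD(1)[OF f], of k g] by simp
      moreover have "\<dots> = k"
        unfolding gf using k smooth_linear_mapsD(1,2)[of k C W] by (simp add: compose_Id)
      ultimately show "k = compose (carrier C) h f" by simp
    qed
  qed
qed

text \<open>A word \<open>[(i\<^sub>1, x\<^sub>1), \<dots>, (i\<^sub>n, x\<^sub>n)]\<close> stands for the formal sum of the vectors
  \<open>x\<^sub>k \<in> Fo i\<^sub>k\<close>.\<close>

definition words :: "('i \<times> 'u) list set" where
  "words = {l. \<forall>(i, x)\<in>set l. i \<in> Ob J \<and> x \<in> carrier (Fo i)}"

definition scale :: "real \<Rightarrow> ('i \<times> 'u) list \<Rightarrow> ('i \<times> 'u) list" where
  "scale a = map (\<lambda>(i, x). (i, a \<odot>\<^bsub>Fo i\<^esub> x))"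

text \<open>The congruence on the monoid of words generated by commutativity, additivity in each
  \<open>Fo i\<close>, and the arrows. A monoid has no cancellation, so \<open>rel_zero\<close> has
  to be imposed: the other rules never relate a nonempty word to the empty one. Compatibility with
  \<open>scale\<close> is derived instead, because scaling each letter maps generators to instances
  of the rules.\<close>

inductive rel :: "('i \<times> 'u) list \<Rightarrow> ('i \<times> 'u) list \<Rightarrow> bool" where
  rel_refl: "l \<in> words \<Longrightarrow> rel l l"
| rel_sym: "rel l m \<Longrightarrow> rel m l"
| rel_trans: "rel l m \<Longrightarrow> rel m k \<Longrightarrow> rel l k"
| rel_append: "rel l m \<Longrightarrow> rel l' m' \<Longrightarrow> rel (l @ l') (m @ m')"
| rel_commute: "l \<in> words \<Longrightarrow> m \<in> words \<Longrightarrow> rel (l @ m) (m @ l)"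
| rel_add: "i \<in> Ob J \<Longrightarrow> x \<in> carrier (Fo i) \<Longrightarrow> y \<in> carrier (Fo i) \<Longrightarrow>
    rel [(i, x \<oplus>\<^bsub>Fo i\<^esub> y)] [(i, x), (i, y)]"
| rel_zero: "i \<in> Ob J \<Longrightarrow> rel [(i, \<zero>\<^bsub>Fo i\<^esub>)] []"
| rel_arrow: "a \<in> Ar J \<Longrightarrow> x \<in> carrier (Fo (Dom J a)) \<Longrightarrow>
    rel [(Dom J a, x)] [(Cod J a, underlying_map (Fa a) x)]"

lemma Nil_words [simp]: "[] \<in> words"
  and Cons_words [simp]: "(i, x) # l \<in> words \<longleftrightarrow> i \<in> Ob J \<and> x \<in> carrier (Fo i) \<and> l \<in> words"
  and append_words [simp]: "l @ m \<in> words \<longleftrightarrow> l \<in> words \<and> m \<in> words"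
  by (auto simp: words_def)

lemma words_induct [consumes 1, case_names Nil Cons]:
  assumes "l \<in> words" and "P []"
    and "\<And>i x l. \<lbrakk>i \<in> Ob J; x \<in> carrier (Fo i); l \<in> words; P l\<rbrakk> \<Longrightarrow> P ((i, x) # l)"
  shows "P l"
  using assms(1) by (induction l) (use assms(2,3) in auto)

lemma Fo_closed:
  assumes "i \<in> Ob J"
  shows "\<zero>\<^bsub>Fo i\<^esub> \<in> carrier (Fo i)"
    and "x \<in> carrier (Fo i) \<Longrightarrow> a \<odot>\<^bsub>Fo i\<^esub> x \<in> carrier (Fo i)"
    and "x \<in> carrier (Fo i) \<Longrightarrow> y \<in> carrier (Fo i) \<Longrightarrow> x \<oplus>\<^bsub>Fo i\<^esub> y \<in> carrier (Fo i)"
proof -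
  interpret diffeological_vector_space "Fo i" using assms by (rule Fo_dvs)
  show "\<zero>\<^bsub>Fo i\<^esub> \<in> carrier (Fo i)"
    and "x \<in> carrier (Fo i) \<Longrightarrow> a \<odot>\<^bsub>Fo i\<^esub> x \<in> carrier (Fo i)"
    and "x \<in> carrier (Fo i) \<Longrightarrow> y \<in> carrier (Fo i) \<Longrightarrow> x \<oplus>\<^bsub>Fo i\<^esub> y \<in> carrier (Fo i)"
    by (auto intro: scale_closed)
qed

lemma scale_words [simp]: "l \<in> words \<Longrightarrow> scale a l \<in> words"
  by (induction l rule: words_induct) (auto simp: scale_def Fo_closed)

lemma scale_append: "scale a (l @ m) = scale a l @ scale a m"
  by (simp add: scale_def)

lemma scale_one: "l \<in> words \<Longrightarrow> scale 1 l = l"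
  by (induction l rule: words_induct)
    (auto simp: scale_def diffeological_vector_space.scale_one[OF Fo_dvs])

lemma scale_scale: "l \<in> words \<Longrightarrow> scale a (scale b l) = scale (a * b) l"
  by (induction l rule: words_induct)
    (auto simp: scale_def diffeological_vector_space.scale_scale[OF Fo_dvs])

lemma rel_words: "rel l m \<Longrightarrow> l \<in> words \<and> m \<in> words"
proof (induction rule: rel.induct)
  case (rel_arrow a x)
  then show ?case
    using smooth_linear_mapsD(3)[OF Fa_arrow(3)] by (simp add: J.Dom_closed J.Cod_closed)
qed (auto simp: Fo_closed)

lemma rel_scale: "rel l m \<Longrightarrow> rel (scale a l) (scale a m)"
proof (induction rule: rel.induct)
  case (rel_trans l m k)
  then show ?case by (blast intro: rel.rel_trans)
next
  case (rel_add i x y)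
  then show ?case
    using rel.rel_add[of i "a \<odot>\<^bsub>Fo i\<^esub> x" "a \<odot>\<^bsub>Fo i\<^esub> y"]
    by (simp add: scale_def Fo_closed diffeological_vector_space.scale_add_right[OF Fo_dvs])
next
  case (rel_zero i)
  then show ?case
    using rel.rel_zero[of i]
    by (simp add: scale_def diffeological_vector_space.scale_zero_right[OF Fo_dvs])
next
  case (rel_arrow b x)
  then show ?case
    using rel.rel_arrow[of b "a \<odot>\<^bsub>Fo (Dom J b)\<^esub> x"] smooth_linear_mapsD(5)[OF Fa_arrow(3)]
    by (simp add: scale_def Fo_closed J.Dom_closed)
qed (auto simp: scale_append intro: rel.intros)

lemma rel_scale_add: "l \<in> words \<Longrightarrow> rel (scale (a + b) l) (scale a l @ scale b l)"
proof (induction l rule: words_induct)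
  case Nil
  then show ?case by (simp add: scale_def rel_refl)
next
  case (Cons i x l)
  let ?a = "[(i, a \<odot>\<^bsub>Fo i\<^esub> x)]" and ?b = "[(i, b \<odot>\<^bsub>Fo i\<^esub> x)]"
  have "rel ([(i, (a + b) \<odot>\<^bsub>Fo i\<^esub> x)] @ scale (a + b) l) ((?a @ ?b) @ (scale a l @ scale b l))"
  proof (rule rel_append)
    show "rel [(i, (a + b) \<odot>\<^bsub>Fo i\<^esub> x)] (?a @ ?b)"
      using Cons rel_add[of i "a \<odot>\<^bsub>Fo i\<^esub> x" "b \<odot>\<^bsub>Fo i\<^esub> x"]
      by (simp add: Fo_closed diffeological_vector_space.scale_add_left[OF Fo_dvs])
  qed (rule Cons.IH)
  \<comment> \<open>Moves the letter of \<open>?b\<close> past \<open>scale a l\<close>, so that the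
    letters scaled by \<open>a\<close> come before those scaled by \<open>b\<close>.\<close>
  moreover have "rel (?a @ (?b @ scale a l) @ scale b l) (?a @ (scale a l @ ?b) @ scale b l)"
    using Cons by (intro rel_append rel_commute rel_refl) (auto simp: Fo_closed)
  ultimately show ?case
    by (auto simp: scale_def intro: rel_trans)
qed

lemma rel_scale_zero: "l \<in> words \<Longrightarrow> rel (scale 0 l) []"
proof (induction l rule: words_induct)
  case Nil
  then show ?case by (simp add: scale_def rel_refl)
next
  case (Cons i x l)
  then show ?case
    using rel_append[OF rel_zero Cons.IH, of i]
    by (simp add: scale_def diffeological_vector_space.scale_zero_left[OF Fo_dvs])
qed

section \<open>Evaluation of formal sums in the vertex of a cocone\<close>

definition word_sum :: "'b dvs \<Rightarrow> ('i \<Rightarrow> 'u \<Rightarrow> 'b) \<Rightarrow> ('i \<times> 'u) list \<Rightarrow> 'b" where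
  "word_sum W \<mu> l = foldr (\<lambda>(i, x) s. \<mu> i x \<oplus>\<^bsub>W\<^esub> s) l \<zero>\<^bsub>W\<^esub>"

lemma word_sum_simps [simp]:
  "word_sum W \<mu> [] = \<zero>\<^bsub>W\<^esub>" "word_sum W \<mu> ((i, x) # l) = \<mu> i x \<oplus>\<^bsub>W\<^esub> word_sum W \<mu> l"
  by (simp_all add: word_sum_def)

context
  fixes W :: "'b dvs" and \<mu> :: "'i \<Rightarrow> 'u \<Rightarrow> 'b"
  assumes \<mu>: "dvect_cocone J Fo Fa W \<mu>"
begin

interpretation W: diffeological_vector_space W
  using \<mu> by (simp add: dvect_cocone_def)

lemma cocone_map: "i \<in> Ob J \<Longrightarrow> \<mu> i \<in> smooth_linear_maps (Fo i) W"
  using \<mu> by (simp add: dvect_cocone_def)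

lemma word_sum_closed [simp]: "l \<in> words \<Longrightarrow> word_sum W \<mu> l \<in> carrier W"
  by (induction l rule: words_induct) (auto simp: smooth_linear_mapsD(3)[OF cocone_map])

lemma word_sum_append:
  "l \<in> words \<Longrightarrow> m \<in> words \<Longrightarrow> word_sum W \<mu> (l @ m) = word_sum W \<mu> l \<oplus>\<^bsub>W\<^esub> word_sum W \<mu> m"
  by (induction l rule: words_induct) (auto simp: smooth_linear_mapsD(3)[OF cocone_map] W.a_assoc)

lemma word_sum_scale: "l \<in> words \<Longrightarrow> word_sum W \<mu> (scale a l) = a \<odot>\<^bsub>W\<^esub> word_sum W \<mu> l"
proof (induction l rule: words_induct)
  case (Cons i x l)
  then show ?case
    by (simp add: scale_def smooth_linear_mapsD(3,5)[OF cocone_map] W.scale_add_right)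
qed (simp add: scale_def W.scale_zero_right)

text \<open>Every generator of \<open>rel\<close> becomes an identity in \<open>W\<close>:
  \<open>rel_commute\<close> by commutativity of addition, \<open>rel_add\<close> and
  \<open>rel_zero\<close> by linearity of the maps \<open>\<mu> i\<close>, and
  \<open>rel_arrow\<close> by the cocone equation. Hence evaluation descends to the classes of
  words.\<close>

lemma word_sum_rel: "rel l m \<Longrightarrow> word_sum W \<mu> l = word_sum W \<mu> m"
proof (induction rule: rel.induct)
  case (rel_append l m l' m')
  then show ?case using rel_words by (simp add: word_sum_append)
next
  case (rel_commute l m)
  then show ?case by (simp add: word_sum_append W.a_comm)
next
  case (rel_add i x y)
  then show ?case by (simp add: smooth_linear_mapsD(3,4)[OF cocone_map])
next
  case (rel_zero i)
  then show ?case
    using smooth_linear_maps_zero[OF Fo_dvs W.diffeological_vector_space_axioms cocone_map] by simp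
next
  case (rel_arrow a x)
  then have "\<mu> (Cod J a) (underlying_map (Fa a) x) = \<mu> (Dom J a) x"
    using \<mu> by (auto simp: dvect_cocone_def dest!: bspec[of "Ar J" _ a] fun_cong[of _ _ x])
      (simp add: compose_def)
  then show ?case by simp
qed auto

end

end

text \<open>\<open>q\<close> stands for the quotient map of words by \<open>rel\<close>, with its
  values placed in the universe. Fixing only its kernel lets finite and infinite universes share the
  construction below.\<close>

locale encoded_dvect_diagram = dvect_diagram J Fo Fa
  for J :: "('i, 'j) cat" and Fo :: "'i \<Rightarrow> 'u dvs" and Fa :: "'j \<Rightarrow> 'u dvs_arrow" +
  fixes q :: "('i \<times> 'u) list \<Rightarrow> 'u"
  assumes q_eq_iff: "\<lbrakk>l \<in> words; m \<in> words\<rbrakk> \<Longrightarrow> q l = q m \<longleftrightarrow> rel l m"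
begin

definition dec :: "'u \<Rightarrow> ('i \<times> 'u) list" where
  "dec c = (SOME l. l \<in> words \<and> q l = c)"

lemma dec:
  assumes "l \<in> words"
  shows "dec (q l) \<in> words" and "rel (dec (q l)) l"
proof -
  have "dec (q l) \<in> words \<and> q (dec (q l)) = q l"
    unfolding dec_def by (rule someI[of _ l]) (simp add: assms)
  with assms show "dec (q l) \<in> words" "rel (dec (q l)) l"
    using q_eq_iff by auto
qed

text \<open>The plots are a parameter because several diffeologies on this one vector space are
  compared: the admissible ones, their intersection, and a pullback. The operations go through
  representatives chosen by \<open>dec\<close>; they are well defined because \<open>rel\<close> is
  compatible with concatenation and scaling.\<close>

definition colim_with :: "'u plots \<Rightarrow> 'u dvs" where
  "colim_with D = \<lparr>carrier = q ` words, mult = undefined, one = undefined, zero = q [],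
    add = (\<lambda>c d. q (dec c @ dec d)), smult = (\<lambda>a c. q (scale a (dec c))), plots = D\<rparr>"

lemma colim_with_simps [simp]:
  "carrier (colim_with D) = q ` words" "plots (colim_with D) = D" "\<zero>\<^bsub>colim_with D\<^esub> = q []"
  "(colim_with D)\<lparr>plots := E\<rparr> = colim_with E"
  by (simp_all add: colim_with_def)

lemma colim_with_add [simp]:
  "\<lbrakk>l \<in> words; m \<in> words\<rbrakk> \<Longrightarrow> q l \<oplus>\<^bsub>colim_with D\<^esub> q m = q (l @ m)"
  by (simp add: colim_with_def q_eq_iff dec rel_append)

lemma colim_with_smult [simp]:
  "l \<in> words \<Longrightarrow> a \<odot>\<^bsub>colim_with D\<^esub> q l = q (scale a l)"
  by (simp add: colim_with_def q_eq_iff dec rel_scale)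

lemma module_colim_with: "module field_of_reals (colim_with D)"
proof (rule moduleI)
  show "abelian_group (colim_with D)"
  proof (rule abelian_groupI)
    fix x y assume "x \<in> carrier (colim_with D)" "y \<in> carrier (colim_with D)"
    then obtain l m where "l \<in> words" "m \<in> words" "x = q l" "y = q m" by auto
    then show "x \<oplus>\<^bsub>colim_with D\<^esub> y = y \<oplus>\<^bsub>colim_with D\<^esub> x"
      by (simp add: q_eq_iff rel_commute)
  next
    fix x assume "x \<in> carrier (colim_with D)"
    then obtain l where l: "l \<in> words" "x = q l" by auto
    \<comment> \<open>The additive inverse comes from the scalar -1: the word shown is related to
      \<open>scale 0 l\<close>, and hence to the empty word.\<close>
    have "rel (scale (- 1) l @ scale 1 l) []"
      using rel_scale_add[OF l(1), of "- 1" 1] rel_scale_zero[OF l(1)]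
      by (auto intro: rel_sym rel_trans)
    with l show "\<exists>y\<in>carrier (colim_with D). y \<oplus>\<^bsub>colim_with D\<^esub> x = \<zero>\<^bsub>colim_with D\<^esub>"
      by (intro bexI[of _ "q (scale (- 1) l)"]) (auto simp: q_eq_iff scale_one)
  qed auto
  fix a b x assume "x \<in> carrier (colim_with D)"
  then obtain l where "l \<in> words" "x = q l" by auto
  then show "(a \<oplus>\<^bsub>field_of_reals\<^esub> b) \<odot>\<^bsub>colim_with D\<^esub> x =
      a \<odot>\<^bsub>colim_with D\<^esub> x \<oplus>\<^bsub>colim_with D\<^esub> b \<odot>\<^bsub>colim_with D\<^esub> x"
    by (simp add: field_of_reals_def q_eq_iff rel_scale_add)
qed (rule cring_field_of_reals, auto simp: field_of_reals_def scale_append scale_one scale_scale)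

definition injection :: "'i \<Rightarrow> 'u \<Rightarrow> 'u" where
  "injection i = (\<lambda>x\<in>carrier (Fo i). q [(i, x)])"

definition admissible :: "'u plots set" where
  "admissible = {E. diffeological_vector_space (colim_with E) \<and>
    (\<forall>i\<in>Ob J. \<forall>n U. \<forall>p\<in>plots (Fo i) n U. compose U (injection i) p \<in> E n U)}"

definition colim :: "'u dvs" where
  "colim = colim_with (\<lambda>n U. {p \<in> U \<rightarrow>\<^sub>E q ` words.
    openin (Euclidean_space n) U \<and> (\<forall>E\<in>admissible. p \<in> E n U)})"

lemma diffeological_vector_space_colim: "diffeological_vector_space colim"
  using diffeological_vector_space_Inter[OF module_colim_with, of admissible]
  by (simp add: admissible_def colim_def)

lemma injection_smooth_linear:
  assumes i: "i \<in> Ob J"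
  shows "injection i \<in> smooth_linear_maps (Fo i) colim"
proof -
  interpret diffeological_vector_space "Fo i" using i by (rule Fo_dvs)
  have "injection i (x \<oplus>\<^bsub>Fo i\<^esub> y) = injection i x \<oplus>\<^bsub>colim\<^esub> injection i y"
    if "x \<in> carrier (Fo i)" "y \<in> carrier (Fo i)" for x y
    using that i by (simp add: injection_def colim_def q_eq_iff rel_add)
  moreover have "injection i (a \<odot>\<^bsub>Fo i\<^esub> x) = a \<odot>\<^bsub>colim\<^esub> injection i x" if "x \<in> carrier (Fo i)" for a x
    using that i by (simp add: injection_def colim_def Fo_closed scale_def)
  moreover have "compose U (injection i) p \<in> plots colim n U" if p: "p \<in> plots (Fo i) n U" for p n U
    using plot_fun[OF p] plot_domain[OF p] p i
    by (auto simp: colim_def admissible_def compose_def injection_def)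
  ultimately show ?thesis
    using i by (auto simp: smooth_linear_maps_def dsmooth_def) (auto simp: injection_def colim_def)
qed

lemma dvect_cocone_colim: "dvect_cocone J Fo Fa colim injection"
  unfolding dvect_cocone_def
proof (intro conjI ballI)
  fix a assume a: "a \<in> Ar J"
  have "underlying_map (Fa a) x \<in> carrier (Fo (Cod J a))" if "x \<in> carrier (Fo (Dom J a))" for x
    using smooth_linear_mapsD(3)[OF Fa_arrow(3)[OF a] that] .
  then show "compose (carrier (Fo (Dom J a))) (injection (Cod J a)) (underlying_map (Fa a)) = injection (Dom J a)"
    using a by (auto simp: compose_def injection_def fun_eq_iff q_eq_iff J.Dom_closed J.Cod_closed
        intro: rel_sym rel_arrow)
qed (auto simp: diffeological_vector_space_colim injection_smooth_linear)

text \<open>The induced map evaluates a representative word, and its smoothness is tested by a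
  diffeology on the carrier of \<open>colim\<close>. The vertex \<open>W\<close> therefore may have
  any underlying type \<open>'b\<close>, whatever its size compared with \<open>'u\<close>.\<close>

lemma dvect_universal_colim:
  "dvect_universal TYPE('b) J Fo Fa colim (\<lambda>i. (Fo i, injection i, colim))"
  unfolding dvect_universal_def
proof (intro allI impI)
  fix W :: "'b dvs" and \<mu>
  assume \<mu>: "dvect_cocone J Fo Fa W \<mu>"
  then interpret W: diffeological_vector_space W by (simp add: dvect_cocone_def)
  define h where "h = (\<lambda>c\<in>q ` words. word_sum W \<mu> (dec c))"
  have h_q: "h (q l) = word_sum W \<mu> l" if "l \<in> words" for l
    using that word_sum_rel[OF \<mu> dec(2)[OF that]] by (simp add: h_def)
  have h_add: "h (x \<oplus>\<^bsub>colim_with D\<^esub> y) = h x \<oplus>\<^bsub>W\<^esub> h y"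
    if "x \<in> q ` words" "y \<in> q ` words" for x y D
    using that by (auto simp: h_q word_sum_append[OF \<mu>])
  have h_smult: "h (a \<odot>\<^bsub>colim_with D\<^esub> x) = a \<odot>\<^bsub>W\<^esub> h x" if "x \<in> q ` words" for a x D
    using that by (auto simp: h_q word_sum_scale[OF \<mu>])
  have h_ext: "h \<in> extensional (q ` words)"
    by (simp add: h_def)
  have h_W: "h \<in> q ` words \<rightarrow> carrier W"
    by (auto simp: h_q word_sum_closed[OF \<mu>])
  have h_injection: "compose (carrier (Fo i)) h (injection i) = \<mu> i" if i: "i \<in> Ob J" for i
  proof -
    have "\<mu> i \<in> extensional (carrier (Fo i))" "\<And>x. x \<in> carrier (Fo i) \<Longrightarrow> \<mu> i x \<in> carrier W"
      using smooth_linear_mapsD(2,3)[OF cocone_map[OF \<mu> i]] .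
    then show ?thesis
      using i by (auto intro!: extensionalityI[of _ "carrier (Fo i)"]
          simp: compose_def injection_def h_q)
  qed
  let ?E = "\<lambda>n U. {p \<in> U \<rightarrow>\<^sub>E q ` words.
    openin (Euclidean_space n) U \<and> compose U h p \<in> plots W n U}"
  \<comment> \<open>The pullback along \<open>h\<close> of the diffeology of \<open>W\<close> is admissible, hence contains the plots of
    \<open>colim\<close>.\<close>
  have "?E \<in> admissible"
  proof -
    have "diffeological_vector_space (colim_with ?E)"
      \<comment> \<open>The plots instantiated with \<open>undefined\<close> are overwritten by the
        pullback diffeology.\<close>
      using diffeological_vector_space_pullback[OF module_colim_with W.diffeological_vector_space_axioms,
          of h undefined] h_W h_add h_smult by simp
    moreover have "compose U (injection i) p \<in> ?E n U"
      if i: "i \<in> Ob J" and p: "p \<in> plots (Fo i) n U" for i n U p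
    proof -
      interpret F: diffeological_vector_space "Fo i" using i by (rule Fo_dvs)
      have pU: "p \<in> U \<rightarrow>\<^sub>E carrier (Fo i)" by (rule F.plot_fun[OF p])
      have "compose U h (compose U (injection i) p) = compose U (compose (carrier (Fo i)) h (injection i)) p"
        using pU by (intro compose_assoc) auto
      also have "\<dots> \<in> plots W n U"
        using smooth_linear_mapsD(6)[OF cocone_map[OF \<mu> i] p] by (simp add: h_injection i)
      finally show ?thesis
        using pU F.plot_domain[OF p] i by (auto simp: compose_def injection_def)
    qed
    ultimately show ?thesis by (simp add: admissible_def)
  qed
  then have h: "h \<in> smooth_linear_maps colim W"
    using h_W h_ext
    by (auto simp: smooth_linear_maps_def dsmooth_def colim_def PiE_iff h_q
        word_sum_closed[OF \<mu>] word_sum_append[OF \<mu>] word_sum_scale[OF \<mu>])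
  \<comment> \<open>The injected vectors span: each element is \<open>q\<close> of a word, hence a
    finite sum of values of the injections, on which a linear map is determined by the
    cocone.\<close>
  have unique: "k = h" if k: "k \<in> smooth_linear_maps colim W"
    and k_injection: "\<forall>i\<in>Ob J. compose (carrier (Fo i)) k (injection i) = \<mu> i" for k
  proof -
    have k_zero: "k (q []) = \<zero>\<^bsub>W\<^esub>"
      using smooth_linear_maps_zero[OF diffeological_vector_space_colim
          W.diffeological_vector_space_axioms k] by (simp add: colim_def)
    have k_add: "k (q (l @ m)) = k (q l) \<oplus>\<^bsub>W\<^esub> k (q m)" if "l \<in> words" "m \<in> words" for l m
      using smooth_linear_mapsD(4)[OF k, of "q l" "q m"] that by (simp add: colim_def)
    have k_q: "k (q l) = word_sum W \<mu> l" if "l \<in> words" for l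
      using that
    proof (induction l rule: words_induct)
      case (Cons i x l)
      then have "k (q [(i, x)]) = \<mu> i x"
        using k_injection[rule_format, of i] by (auto simp: compose_def injection_def dest: fun_cong[of _ _ x])
      with Cons k_add[of "[(i, x)]" l] show ?case by simp
    qed (simp add: k_zero)
    show ?thesis
      using smooth_linear_mapsD(2)[OF k]
      by (intro extensionalityI[of _ "q ` words"]) (auto simp: colim_def h_ext h_q k_q)
  qed
  show "\<exists>!k. k \<in> smooth_linear_maps colim W \<and>
      (\<forall>i\<in>Ob J. compose (carrier (Fo i)) k (underlying_map (Fo i, injection i, colim)) = \<mu> i)"
    unfolding fst_conv snd_conv
  proof (rule ex1I[of _ h])
    show "h \<in> smooth_linear_maps colim W \<and>
        (\<forall>i\<in>Ob J. compose (carrier (Fo i)) h (injection i) = \<mu> i)"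
      using h h_injection by blast
  qed (use unique in blast)
qed

end

section \<open>Encoding words in the universe\<close>

lemma infinite_imp_inj_list:
  assumes "infinite (UNIV :: 'a set)"
  shows "\<exists>f :: 'a list \<Rightarrow> 'a. inj f"
proof -
  obtain g :: "'a \<times> 'a \<Rightarrow> 'a" where "bij_betw g (UNIV \<times> UNIV) UNIV"
    using card_of_Times_same_infinite[OF assms] by (auto simp: card_of_ordIso[symmetric])
  then have g: "g p = g r \<longleftrightarrow> p = r" for p r
    by (simp add: bij_betw_def inj_eq)
  obtain c :: "nat \<Rightarrow> 'a" where c: "inj c"
    using assms by (auto simp: infinite_iff_countable_subset)
  \<comment> \<open>Since \<open>g\<close> is surjective, \<open>c 0\<close> is itself the code of a
    pair and does not mark the end of a list. So \<open>e\<close> is only shown to separate lists of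
    equal length, and the final code records the length through \<open>c\<close>.\<close>
  define e where "e l = foldr (\<lambda>x y. g (x, y)) l (c 0)" for l
  have "l = m" if "length l = length m" "e l = e m" for l m
    using that by (induction l m rule: list_induct2) (auto simp: e_def g)
  then have "inj (\<lambda>l. g (c (length l), e l))"
    using c by (auto simp: inj_def g)
  then show ?thesis by blast
qed

lemma infinite_imp_inj_list_prod:
  assumes "infinite (UNIV :: 'a set)"
  shows "\<exists>f :: ('a \<times> 'a) list \<Rightarrow> 'a. inj f"
proof -
  obtain f :: "'a list \<Rightarrow> 'a" where f: "inj f"
    using infinite_imp_inj_list[OF assms] by blast
  \<comment> \<open>A pair is coded as a list of length two; a list of pairs then becomes a list of
    codes, which \<open>f\<close> encodes again.\<close>
  have "inj (\<lambda>(x, y). f [x, y])"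
    using f by (auto simp: inj_def)
  then have "inj (f \<circ> map (\<lambda>(x, y). f [x, y]))"
    using f by (intro inj_compose) (auto simp: inj_mapI)
  then show ?thesis by blast
qed

lemma encoding_exists:
  fixes J :: "('u, 'j) cat" and Fo :: "'u \<Rightarrow> 'u dvs"
  assumes "dvect_diagram J Fo Fa"
  shows "\<exists>q :: ('u \<times> 'u) list \<Rightarrow> 'u. encoded_dvect_diagram J Fo Fa q"
proof -
  interpret dvect_diagram J Fo Fa by (rule assms)
  have "\<exists>q :: ('u \<times> 'u) list \<Rightarrow> 'u. \<forall>l\<in>words. \<forall>m\<in>words. q l = q m \<longleftrightarrow> rel l m"
  proof (cases "finite (UNIV :: 'u set)")
    \<comment> \<open>A real vector space with finitely many elements is zero.\<close>
    case True
    have Nil: "rel l []" if "l \<in> words" for l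
      using that
    proof (induction l rule: words_induct)
      case (Cons i x l)
      then have "x = \<zero>\<^bsub>Fo i\<^esub>"
        using diffeological_vector_space.carrier_finite_imp_zero[OF Fo_dvs] finite_subset[OF _ True]
        by blast
      with Cons rel_append[OF rel_zero, of i l "[]"] show ?case by simp
    qed (simp add: rel_refl)
    have "rel l m" if "l \<in> words" "m \<in> words" for l m
      using Nil[OF that(1)] rel_sym[OF Nil[OF that(2)]] by (rule rel_trans)
    \<comment> \<open>All words form a single class, so any constant map serves as the quotient
      map.\<close>
    then show ?thesis by (intro exI[of _ "\<lambda>_. undefined"]) simp
  next
    case False
    then obtain f :: "('u \<times> 'u) list \<Rightarrow> 'u" where f: "inj f"
      using infinite_imp_inj_list_prod by blast
    \<comment> \<open>A representative is chosen in each class and then encoded by \<open>f\<close>.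
      Related words have equal predicates \<open>rel l\<close>, so the choice is the same for
      both.\<close>
    have rep: "rel l (SOME k. rel l k)" if "l \<in> words" for l
      using rel_refl[OF that] by (rule someI)
    have "f (SOME k. rel l k) = f (SOME k. rel m k) \<longleftrightarrow> rel l m"
      if "l \<in> words" "m \<in> words" for l m
    proof
      assume "f (SOME k. rel l k) = f (SOME k. rel m k)"
      then have eq: "(SOME k. rel l k) = (SOME k. rel m k)" by (rule injD[OF f])
      show "rel l m"
        using rep[OF that(1), unfolded eq] rel_sym[OF rep[OF that(2)]] by (rule rel_trans)
    next
      assume "rel l m"
      then have "rel l = rel m"
        by (intro ext) (metis rel_sym rel_trans)
      then show "f (SOME k. rel l k) = f (SOME k. rel m k)" by simp
    qed
    then show ?thesis by (intro exI[of _ "\<lambda>l. f (SOME k. rel l k)"]) simp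
  qed
  then obtain q :: "('u \<times> 'u) list \<Rightarrow> 'u"
    where q: "\<forall>l\<in>words. \<forall>m\<in>words. q l = q m \<longleftrightarrow> rel l m" by blast
  have "encoded_dvect_diagram J Fo Fa q"
    by unfold_locales (use q in blast)
  then show ?thesis by blast
qed

theorem theorem3p3:
  shows "cocomplete TYPE('u) (DVect :: ('u dvs, 'u dvs_arrow) cat) \<and>
    (\<forall>(J :: ('u, 'u) cat) Fo Fa (C :: 'u dvs) \<iota>.
       cat_functor J DVect Fo Fa \<and> colimit J DVect Fo Fa C \<iota> \<longrightarrow>
       dvect_universal TYPE('b) J Fo Fa C \<iota>)"
proof (intro conjI allI impI)
  \<comment> \<open>Both properties are obtained for the same vertex: the first gives
    cocompleteness, and the pair provides the reference colimit to which any other colimit is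
    compared. They come from \<open>dvect_universal_colim\<close> at the types \<open>'u\<close> and
    \<open>'b\<close>.\<close>
  have colim: "\<exists>C \<iota>. colimit J DVect Fo Fa C \<iota> \<and> dvect_universal TYPE('b) J Fo Fa C \<iota>"
    if F: "cat_functor J DVect Fo Fa" for J :: "('u, 'u) cat" and Fo :: "'u \<Rightarrow> 'u dvs" and Fa
  proof -
    have "dvect_diagram J Fo Fa"
      using F by (rule dvect_diagram.intro)
    then obtain q where "encoded_dvect_diagram J Fo Fa q"
      using encoding_exists by blast
    then interpret encoded_dvect_diagram J Fo Fa q .
    have "colimit J DVect Fo Fa colim (\<lambda>i. (Fo i, injection i, colim))"
      unfolding colimit_DVect_iff cocone_DVect_iff
      using dvect_cocone_colim dvect_universal_colim by simp
    then show ?thesis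
      using dvect_universal_colim by blast
  qed
  show "cocomplete TYPE('u) (DVect :: ('u dvs, 'u dvs_arrow) cat)"
    unfolding cocomplete_def using category_DVect colim by blast
  fix J :: "('u, 'u) cat" and Fo Fa and C :: "'u dvs" and \<iota>
  assume "cat_functor J DVect Fo Fa \<and> colimit J DVect Fo Fa C \<iota>"
  then have F: "cat_functor J DVect Fo Fa" and C: "colimit J DVect Fo Fa C \<iota>"
    by simp_all
  interpret dvect_diagram J Fo Fa
    using F by (rule dvect_diagram.intro)
  obtain C' \<iota>' where C': "colimit J DVect Fo Fa C' \<iota>'" "dvect_universal TYPE('b) J Fo Fa C' \<iota>'"
    using colim[OF F] by blast
  show "dvect_universal TYPE('b) J Fo Fa C \<iota>"
    using dvect_universal_transport[of C \<iota> C' \<iota>'] C C'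
    by (simp add: colimit_DVect_iff cocone_DVect_iff)
qed

end
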